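(* Let $M\in\mathbb{R}^{m\times n}$ and $\mu>0$, and set $$B:=(I+\mu M^\top M)^{-1},\qquad C:=(M^\top M+\mu^{-1}I)^{-1}M^\top,\qquad \varphi(\Phi):=B\Phi+C\quad(\Phi\in\mathbb{R}^{n\times m}).$$ Then the pseudo-inverse $M^\dagger$ satisfies the fixed point equation $M^\dagger=\varphi(M^\dagger)$. The fixed point iteration $\Phi_{k+1}=B\Phi_k+C$ coincides with the proximal iteration with constant parameter $\mu$ for the function $f(\Phi)=\frac12\|M\Phi-I\|_F^2$, that is, $$B\Phi_k+C=\operatorname*{argmin}_{\Phi\in\mathbb{R}^{n\times m}}\Big\{\tfrac12\|M\Phi-I\|_F^2+\frac{1}{2\mu}\|\Phi-\Phi_k\|_F^2\Big\}\quad\text{for every }\Phi_k\in\mathbb{R}^{n\times m}.$$ Moreover $\varphi$ is a contraction and, if $M^\top M$ is positive definite, then $\varphi$ is a strict contraction.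
   Context: $\|\cdot\|_F$ is the Frobenius norm, $I$ an identity matrix of the appropriate size, and $M^\dagger\in\mathbb{R}^{n\times m}$ the Moore–Penrose pseudo-inverse of $M$. Here "contraction" means $\|\varphi(\Phi)-\varphi(\Psi)\|_F\le\|\Phi-\Psi\|_F$ for all $\Phi,\Psi$ (nonexpansive), and "strict contraction" means that there is a constant $c<1$ with $\|\varphi(\Phi)-\varphi(\Psi)\|_F\le c\|\Phi-\Psi\|_F$ for all $\Phi,\Psi$. *)

theory Defs
  imports "HOL-Analysis.Analysis"
begin

definition frobenius_norm :: "real^'n^'m \<Rightarrow> real" where
  "frobenius_norm A = sqrt (\<Sum>i\<in>UNIV. \<Sum>j\<in>UNIV. (A $ i $ j)\<^sup>2)"

lemma frobenius_norm_eq_norm: "frobenius_norm A = norm A"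
  by (simp add: frobenius_norm_def norm_vec_def L2_set_def sum_nonneg)

text \<open>The four Penrose equations. Every real matrix has exactly one solution, so the definite
  description below is well-defined.\<close>

definition is_pseudo_inverse :: "real^'n^'m \<Rightarrow> real^'m^'n \<Rightarrow> bool" where
  "is_pseudo_inverse M X \<longleftrightarrow>
     M ** X ** M = M \<and> X ** M ** X = X \<and>
     transpose (M ** X) = M ** X \<and> transpose (X ** M) = X ** M"

definition pseudo_inverse :: "real^'n^'m \<Rightarrow> real^'m^'n" where
  "pseudo_inverse M = (THE X. is_pseudo_inverse M X)"

definition positive_definite :: "real^'n^'n \<Rightarrow> bool" where
  "positive_definite A \<longleftrightarrow> transpose A = A \<and> (\<forall>x. x \<noteq> 0 \<longrightarrow> x \<bullet> (A *v x) > 0)"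

text \<open>A contraction is merely nonexpansive here; the strict notion asks for one uniform
  Lipschitz constant below 1.\<close>

definition contraction :: "(real^'m^'n \<Rightarrow> real^'m^'n) \<Rightarrow> bool" where
  "contraction \<phi> \<longleftrightarrow>
     (\<forall>\<Phi> \<Psi>. frobenius_norm (\<phi> \<Phi> - \<phi> \<Psi>) \<le> frobenius_norm (\<Phi> - \<Psi>))"

definition strict_contraction :: "(real^'m^'n \<Rightarrow> real^'m^'n) \<Rightarrow> bool" where
  "strict_contraction \<phi> \<longleftrightarrow>
     (\<exists>c<1. \<forall>\<Phi> \<Psi>. frobenius_norm (\<phi> \<Phi> - \<phi> \<Psi>) \<le> c * frobenius_norm (\<Phi> - \<Psi>))"

text \<open>The set of all global minimisers; an informal \<open>x = argmin f\<close> is stated as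
  \<open>argmin_set f = {x}\<close>, i.e. the minimiser exists, is unique and is \<open>x\<close>.\<close>

definition argmin_set :: "('a \<Rightarrow> real) \<Rightarrow> 'a set" where
  "argmin_set f = {x. is_arg_min f (\<lambda>_. True) x}"

definition proximal_iteration ::
    "(real^'m^'n \<Rightarrow> real) \<Rightarrow> real \<Rightarrow> (nat \<Rightarrow> real^'m^'n) \<Rightarrow> bool" where
  "proximal_iteration f \<mu> \<Phi> \<longleftrightarrow>
     (\<forall>k. argmin_set (\<lambda>\<Psi>. f \<Psi> + 1 / (2 * \<mu>) * (frobenius_norm (\<Psi> - \<Phi> k))\<^sup>2)
            = {\<Phi> (Suc k)})"

end

theory Submission
  imports Defs
begin

text \<open>Put \<open>A = M\<^sup>T M\<close> and \<open>R = I + \<mu> A\<close>. Then \<open>B = R\<^sup>-\<^sup>1\<close> and \<open>C = \<mu> B M\<^sup>T\<close>, so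
  \<open>P = \<phi>(\<Phi>)\<close> is the unique solution of \<open>R P = \<Phi> + \<mu> M\<^sup>T\<close>. For \<open>P = \<Phi> = M\<^sup>\<dagger>\<close> this is the normal equation
  \<open>A M\<^sup>\<dagger> = M\<^sup>T\<close>, and in general it is the stationarity condition of the proximal objective, whose
  expansion around \<open>P\<close> therefore has no linear term. The Lipschitz bounds come from
  \<open>\<parallel>R Z\<parallel>\<^sup>2 = \<parallel>Z\<parallel>\<^sup>2 + 2 \<mu> \<parallel>M Z\<parallel>\<^sup>2 + \<mu>\<^sup>2 \<parallel>A Z\<parallel>\<^sup>2\<close>.
  The pseudo-inverse exists because, with \<open>Q\<close> the orthogonal projection onto \<open>ker M\<close>, the matrix
  \<open>A + Q\<close> is invertible and \<open>(A + Q)\<^sup>-\<^sup>1 M\<^sup>T\<close> solves the Penrose equations.\<close>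

section \<open>Matrix algebra and the Frobenius inner product\<close>

lemma bounded_bilinear_matrix_mult:
  "bounded_bilinear ((**) :: real^'n^'m \<Rightarrow> real^'p^'n \<Rightarrow> real^'p^'m)"
  unfolding bilinear_conv_bounded_bilinear[symmetric] bilinear_def linear_iff
  by (simp add: matrix_add_ldistrib matrix_scalar_ac scalar_matrix_assoc)
    (simp add: matrix_matrix_mult_def vec_eq_iff distrib_right sum.distrib)

text \<open>Supplies the rules for differences and scalar multiples, and also the boundedness of
  left multiplication by a fixed matrix, which later yields the strict contraction constant.\<close>

interpretation matrix_mult: bounded_bilinear "(**) :: real^'n^'m \<Rightarrow> real^'p^'n \<Rightarrow> real^'p^'m"
  by (rule bounded_bilinear_matrix_mult)

lemma transpose_add: "transpose (A + B) = transpose A + transpose (B :: 'a::plus^'n^'m)"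
  by (simp add: transpose_def vec_eq_iff)

text \<open>The inner product of this matrix type is the Frobenius one, so both sides are the same
  triple sum, reordered.\<close>

lemma inner_matrix_mult_left:
  fixes A :: "real^'n^'m" and X :: "real^'p^'n" and Y :: "real^'p^'m"
  shows "inner (A ** X) Y = inner X (transpose A ** Y)"
proof -
  have "inner (A ** X) Y = (\<Sum>i\<in>UNIV. \<Sum>j\<in>UNIV. \<Sum>k\<in>UNIV. A$i$k * X$k$j * Y$i$j)"
    by (simp add: inner_vec_def matrix_matrix_mult_def sum_distrib_right)
  also have "\<dots> = (\<Sum>i\<in>UNIV. \<Sum>k\<in>UNIV. \<Sum>j\<in>UNIV. A$i$k * X$k$j * Y$i$j)"
    by (intro sum.cong refl sum.swap)
  also have "\<dots> = (\<Sum>k\<in>UNIV. \<Sum>i\<in>UNIV. \<Sum>j\<in>UNIV. A$i$k * X$k$j * Y$i$j)"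
    by (rule sum.swap)
  also have "\<dots> = (\<Sum>k\<in>UNIV. \<Sum>j\<in>UNIV. \<Sum>i\<in>UNIV. A$i$k * X$k$j * Y$i$j)"
    by (intro sum.cong refl sum.swap)
  also have "\<dots> = inner X (transpose A ** Y)"
    by (simp add: inner_vec_def matrix_matrix_mult_def transpose_def sum_distrib_left mult_ac)
  finally show ?thesis .
qed

lemma inner_gram_mult:
  fixes M :: "real^'n^'m" and X Y :: "real^'p^'n"
  shows "inner X (transpose M ** M ** Y) = inner (M ** X) (M ** Y)"
  by (simp add: inner_matrix_mult_left matrix_mul_assoc)

lemma inner_gram_vec:
  fixes M :: "real^'n^'m"
  shows "x \<bullet> ((transpose M ** M) *v x) = (norm (M *v x))\<^sup>2"
  by (simp add: power2_norm_eq_inner dot_lmul_matrix[symmetric] matrix_vector_mul_assoc[symmetric] inner_commute)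

lemma matrix_inv_unique:
  fixes A X :: "real^'n^'n"
  assumes "X ** A = mat 1"
  shows "matrix_inv A = X"
proof -
  have "A ** X = mat 1"
    using assms by (simp add: matrix_left_right_inverse)
  then have "A ** matrix_inv A = mat 1"
    unfolding matrix_inv_def using assms by (metis (mono_tags, lifting) someI_ex)
  then have "X ** A ** matrix_inv A = X"
    by (simp add: matrix_mul_assoc[symmetric])
  then show ?thesis
    by (simp add: assms)
qed

text \<open>Definiteness forces a trivial kernel. The lemma is applied to \<open>A + Q\<close> for
  the pseudo-inverse, to the resolvent matrix \<open>R\<close>, and to \<open>A\<close> for the
  strict bound.\<close>

lemma matrix_left_inverse_if_definite:
  fixes A :: "real^'n^'n"
  assumes "\<And>x. x \<noteq> 0 \<Longrightarrow> x \<bullet> (A *v x) > 0"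
  obtains S where "S ** A = mat 1"
proof -
  have "\<forall>x. A *v x = 0 \<longrightarrow> x = 0"
    using assms by (metis inner_zero_right less_irrefl)
  then show ?thesis
    using that by (auto simp: matrix_left_invertible_ker[symmetric])
qed

section \<open>Existence and uniqueness of the pseudo-inverse\<close>

lemma kernel_projection_exists:
  fixes M :: "real^'n^'m"
  obtains Q :: "real^'n^'n" where "transpose Q = Q" "Q ** Q = Q" "M ** Q = 0"
    "\<And>x. M *v x = 0 \<Longrightarrow> Q *v x = x"
proof -
  define N where "N = {x. M *v x = 0}"
  have "subspace N"
    by (auto simp: N_def subspace_def matrix_vector_right_distrib matrix_vector_mult_scaleR)
  then obtain E where EN: "E \<subseteq> N" and orth: "pairwise orthogonal E"
    and unit: "\<And>b. b \<in> E \<Longrightarrow> norm b = 1" and "independent E" and spn: "span E = N"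
    using orthonormal_basis_subspace by metis
  have fin: "finite E"
    using \<open>independent E\<close> by (rule independent_imp_finite)
  \<comment> \<open>Orthogonal projection onto \<open>N\<close>, written in the orthonormal basis
    \<open>E\<close>. It fixes each basis vector, hence all of \<open>N\<close> by
    linearity.\<close>
  define f where "f = (\<lambda>x. \<Sum>b\<in>E. (b \<bullet> x) *\<^sub>R b)"
  have lin: "linear f"
    by (auto simp: f_def linear_iff inner_add_right scaleR_add_left sum.distrib scaleR_sum_right)
  have Qv: "matrix f *v x = f x" for x
    using lin by (simp add: matrix_works linear_linear)
  have "f b = b" if "b \<in> E" for b
  proof -
    have "f b = (\<Sum>c\<in>E. if c = b then b else 0)"
      unfolding f_def
    proof (rule sum.cong)
      fix c assume "c \<in> E"
      then show "(c \<bullet> b) *\<^sub>R c = (if c = b then b else 0)"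
        using orth that unit[OF that] by (auto simp: pairwise_def orthogonal_def dot_square_norm)
    qed simp
    then show ?thesis
      using fin that by simp
  qed
  then have f_N: "f x = x" if "x \<in> N" for x
    using linear_eq_on_span[OF lin linear_id, of E x] that spn by auto
  have f_in: "f x \<in> N" for x
    unfolding f_def using EN by (intro subspace_sum subspace_scale \<open>subspace N\<close>) blast
  show thesis
  proof
    \<comment> \<open>Entry \<open>(i, j)\<close> is the sum of \<open>b$i * b$j\<close> over
      \<open>b\<close> in \<open>E\<close>.\<close>
    show "transpose (matrix f) = matrix f"
      by (simp add: transpose_def matrix_def f_def vec_eq_iff inner_axis mult.commute)
    show "matrix f ** matrix f = matrix f"
      by (simp add: matrix_eq matrix_vector_mul_assoc[symmetric] Qv f_N f_in)
    show "M ** matrix f = 0"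
      using f_in by (simp add: matrix_eq matrix_vector_mul_assoc[symmetric] Qv N_def)
    show "matrix f *v x = x" if "M *v x = 0" for x
      using that by (simp add: Qv f_N N_def)
  qed
qed

lemma pseudo_inverse_exists:
  fixes M :: "real^'n^'m"
  obtains X where "is_pseudo_inverse M X"
proof -
  obtain Q :: "real^'n^'n" where Q: "transpose Q = Q" "Q ** Q = Q" "M ** Q = 0"
    and Qker: "\<And>x. M *v x = 0 \<Longrightarrow> Q *v x = x"
    using kernel_projection_exists[of M] by blast
  have QM: "Q ** transpose M = 0"
    using matrix_transpose_mul[of M Q] by (simp add: Q) (simp add: transpose_def vec_eq_iff)
  define A where "A = transpose M ** M"
  have QQ: "x \<bullet> (Q *v x) = (norm (Q *v x))\<^sup>2" for x
    using inner_gram_vec[of x Q] Q by simp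
  have "x \<bullet> ((A + Q) *v x) > 0" if "x \<noteq> 0" for x
  proof -
    have "x \<bullet> ((A + Q) *v x) = (norm (M *v x))\<^sup>2 + (norm (Q *v x))\<^sup>2"
      by (simp add: A_def inner_add_right matrix_vector_mult_add_rdistrib inner_gram_vec QQ)
    \<comment> \<open>If both vanished, \<open>x\<close> would lie in the kernel of
      \<open>M\<close>, so \<open>x = Q *v x = 0\<close>.\<close>
    moreover have "M *v x \<noteq> 0 \<or> Q *v x \<noteq> 0"
      using Qker that by metis
    ultimately show ?thesis
      by (metis add_pos_nonneg add_nonneg_pos zero_le_power2 zero_less_norm_iff zero_less_power)
  qed
  then obtain S where S: "S ** (A + Q) = mat 1"
    by (rule matrix_left_inverse_if_definite)
  have S': "(A + Q) ** S = mat 1"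
    using S by (simp add: matrix_left_right_inverse)
  have "transpose (A + Q) = A + Q"
    by (simp add: A_def transpose_add matrix_transpose_mul Q)
  then have "transpose S ** (A + Q) = mat 1"
    using S' by (metis matrix_transpose_mul transpose_mat)
  then have Ssym: "transpose S = S"
    using S matrix_inv_unique by metis
  \<comment> \<open>\<open>A\<close> and \<open>Q\<close> annihilate each other on both sides, so
    \<open>A + Q\<close>, and with it \<open>S\<close>, acts as the identity on \<open>Q\<close>.
    Hence \<open>S ** A = S ** (A + Q) - S ** Q = mat 1 - Q\<close>.\<close>
  have "(A + Q) ** Q = Q" "Q ** (A + Q) = Q"
    by (simp_all add: A_def matrix_mult.add_left matrix_add_ldistrib Q QM
        matrix_mul_assoc[symmetric]) (simp add: matrix_mul_assoc QM)
  then have SQ: "S ** Q = Q" and QS: "Q ** S = Q"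
    using S S' by (metis matrix_mul_assoc matrix_mul_lid, metis matrix_mul_assoc matrix_mul_rid)
  have SA: "S ** A = mat 1 - Q"
    using S SQ by (simp add: matrix_add_ldistrib algebra_simps)
  define X where "X = S ** transpose M"
  have XM: "X ** M = mat 1 - Q"
    using SA by (simp add: X_def A_def matrix_mul_assoc)
  have "Q ** X = 0"
    by (simp add: X_def matrix_mul_assoc QS QM)
  then have "X ** M ** X = X"
    by (simp add: XM matrix_mult.diff_left)
  moreover have "M ** X ** M = M"
    by (simp add: matrix_mul_assoc[symmetric] XM matrix_mult.diff_right Q)
  moreover have "transpose (M ** X) = M ** X"
    by (simp add: X_def matrix_transpose_mul Ssym matrix_mul_assoc)
  moreover have "transpose (X ** M) = X ** M"
    unfolding XM using Q(1) by (simp add: transpose_def mat_def vec_eq_iff)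
  ultimately show thesis
    using that by (simp add: is_pseudo_inverse_def)
qed

text \<open>By symmetry \<open>M ** Y ** M ** X\<close> is the transpose of
  \<open>M ** X ** M ** Y = M ** Y\<close>, which gives \<open>M ** X = M ** Y\<close>; likewise on
  the other side. Then \<open>X = X ** M ** X\<close> can be rewritten to
  \<open>Y ** M ** Y = Y\<close>.\<close>

lemma is_pseudo_inverse_unique:
  assumes "is_pseudo_inverse M X" "is_pseudo_inverse M Y"
  shows "X = Y"
proof -
  note X = assms(1)[unfolded is_pseudo_inverse_def] and Y = assms(2)[unfolded is_pseudo_inverse_def]
  have "M ** X = M ** Y ** (M ** X)"
    using Y by (simp add: matrix_mul_assoc)
  also have "\<dots> = transpose (M ** X ** (M ** Y))"
    using X Y by (simp add: matrix_transpose_mul)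
  also have "M ** X ** (M ** Y) = M ** Y"
    using X by (simp add: matrix_mul_assoc)
  finally have MX: "M ** X = M ** Y"
    using Y by simp
  have "X ** M = X ** M ** (Y ** M)"
    using Y by (metis matrix_mul_assoc)
  also have "\<dots> = transpose (Y ** M ** (X ** M))"
    using X Y by (simp add: matrix_transpose_mul)
  also have "Y ** M ** (X ** M) = Y ** M"
    using X by (metis matrix_mul_assoc)
  finally have XM: "X ** M = Y ** M"
    using Y by simp
  have "X = X ** M ** X"
    using X by simp
  also have "\<dots> = Y ** M ** Y"
    by (metis MX XM matrix_mul_assoc)
  finally show ?thesis
    using Y by simp
qed

lemma is_pseudo_inverse_pseudo_inverse: "is_pseudo_inverse M (pseudo_inverse M)"
  unfolding pseudo_inverse_def
  by (metis is_pseudo_inverse_unique pseudo_inverse_exists theI)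

lemma pseudo_inverse_normal_equation:
  "transpose M ** M ** pseudo_inverse M = transpose M"
proof -
  have "transpose M ** transpose (M ** pseudo_inverse M) = transpose (M ** pseudo_inverse M ** M)"
    by (simp add: matrix_transpose_mul)
  then show ?thesis
    using is_pseudo_inverse_pseudo_inverse[of M]
    by (simp add: is_pseudo_inverse_def matrix_mul_assoc)
qed

section \<open>The proximal objective and the resolvent identity\<close>

lemma argmin_set_eq_singleton:
  assumes "\<And>x. x \<noteq> p \<Longrightarrow> f p < f x"
  shows "argmin_set f = {p}"
  using assms by (force simp: argmin_set_def is_arg_min_def)

lemma norm_add_square:
  fixes x y :: "'a::real_inner"
  shows "(norm (x + y))\<^sup>2 = (norm x)\<^sup>2 + 2 * (x \<bullet> y) + (norm y)\<^sup>2"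
  by (simp add: power2_norm_eq_inner inner_add_left inner_add_right inner_commute)

text \<open>The hypothesis is the stationarity condition at \<open>P\<close>, multiplied by \<mu>.
  The last two summands are the excess over the value at \<open>P\<close>; the final one is positive
  unless \<open>\<Psi> = P\<close>, which makes the minimiser unique.\<close>

lemma proximal_objective_expansion:
  fixes M :: "real^'n^'m" and P \<Phi> \<Psi> :: "real^'p^'n" and Y :: "real^'p^'m"
  assumes "\<mu> > 0" and P: "P + \<mu> *\<^sub>R (transpose M ** M ** P) = \<Phi> + \<mu> *\<^sub>R (transpose M ** Y)"
  shows "1/2 * (norm (M ** \<Psi> - Y))\<^sup>2 + 1 / (2 * \<mu>) * (norm (\<Psi> - \<Phi>))\<^sup>2
    = 1/2 * (norm (M ** P - Y))\<^sup>2 + 1 / (2 * \<mu>) * (norm (P - \<Phi>))\<^sup>2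
      + 1/2 * (norm (M ** (\<Psi> - P)))\<^sup>2 + 1 / (2 * \<mu>) * (norm (\<Psi> - P))\<^sup>2"
proof -
  define H where "H = \<Psi> - P"
  have "(M ** P - Y) \<bullet> (M ** H) = (transpose M ** (M ** P - Y)) \<bullet> H"
    using inner_matrix_mult_left[of M H "M ** P - Y"] by (simp add: inner_commute)
  moreover have "P - \<Phi> = - \<mu> *\<^sub>R (transpose M ** (M ** P - Y))"
    using P by (simp add: matrix_mult.diff_right matrix_mul_assoc algebra_simps)
  \<comment> \<open>With the weights 1/2 and \<open>1 / (2 * \<mu>)\<close>, this makes the cross
    terms of the two squares cancel.\<close>
  ultimately have cross: "(P - \<Phi>) \<bullet> H = - \<mu> * ((M ** P - Y) \<bullet> (M ** H))"
    by simp
  have "M ** \<Psi> - Y = (M ** P - Y) + M ** H" "\<Psi> - \<Phi> = (P - \<Phi>) + H"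
    by (simp_all add: H_def matrix_mult.diff_right)
  then show ?thesis
    unfolding H_def[symmetric]
    using \<open>\<mu> > 0\<close> cross by (simp only: norm_add_square) (simp add: field_simps)
qed

lemma norm_resolvent_square:
  fixes M :: "real^'n^'m" and Z :: "real^'p^'n"
  shows "(norm (Z + \<mu> *\<^sub>R (transpose M ** M ** Z)))\<^sup>2
    = (norm Z)\<^sup>2 + 2 * \<mu> * (norm (M ** Z))\<^sup>2 + \<mu>\<^sup>2 * (norm (transpose M ** M ** Z))\<^sup>2"
  by (simp add: norm_add_square inner_gram_mult power_mult_distrib power2_norm_eq_inner[of "M ** Z"])

section \<open>Fixed point equation, proximal step and Lipschitz bounds\<close>

theorem mainTheorem2:
  fixes M :: "real^'n^'m" and \<mu> :: real
    and B :: "real^'n^'n" and C :: "real^'m^'n"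
    and \<phi> :: "real^'m^'n \<Rightarrow> real^'m^'n"
  assumes "\<mu> > 0"
    and "B = matrix_inv (mat 1 + \<mu> *\<^sub>R (transpose M ** M))"
    and "C = matrix_inv (transpose M ** M + inverse \<mu> *\<^sub>R mat 1) ** transpose M"
    and "\<phi> = (\<lambda>\<Phi>. B ** \<Phi> + C)"
  shows "pseudo_inverse M = \<phi> (pseudo_inverse M)
    \<and> (\<forall>\<Phi> :: nat \<Rightarrow> real^'m^'n.
          (\<forall>k. \<Phi> (Suc k) = B ** \<Phi> k + C) \<longleftrightarrow>
          proximal_iteration (\<lambda>\<Psi>. 1/2 * (frobenius_norm (M ** \<Psi> - mat 1))\<^sup>2) \<mu> \<Phi>)
    \<and> (\<forall>\<Phi>\<^sub>k. argmin_set (\<lambda>\<Phi>. 1/2 * (frobenius_norm (M ** \<Phi> - mat 1))\<^sup>2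
                               + 1 / (2 * \<mu>) * (frobenius_norm (\<Phi> - \<Phi>\<^sub>k))\<^sup>2)
              = {B ** \<Phi>\<^sub>k + C})
    \<and> contraction \<phi>
    \<and> (positive_definite (transpose M ** M) \<longrightarrow> strict_contraction \<phi>)"
proof -
  define A where "A = transpose M ** M"
  define R where "R = mat 1 + \<mu> *\<^sub>R A"
  have "x \<bullet> (R *v x) > 0" if "x \<noteq> 0" for x
  proof -
    have "x \<bullet> (R *v x) = (norm x)\<^sup>2 + \<mu> * (norm (M *v x))\<^sup>2"
      by (simp add: R_def A_def matrix_vector_mult_add_rdistrib inner_add_right
          scaleR_matrix_vector_assoc[symmetric] inner_gram_vec power2_norm_eq_inner[of x])
    then show ?thesis
      using \<open>\<mu> > 0\<close> that by (simp add: add_pos_nonneg)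
  qed
  then obtain S where "S ** R = mat 1"
    by (rule matrix_left_inverse_if_definite)
  moreover from this have "B = S"
    using assms(2) by (simp add: R_def A_def matrix_inv_unique)
  ultimately have BR: "B ** R = mat 1"
    by simp
  then have RB: "R ** B = mat 1"
    by (simp add: matrix_left_right_inverse)
  have Rmult: "R ** Z = Z + \<mu> *\<^sub>R (A ** Z)" for Z :: "real^'m^'n"
    by (simp add: R_def matrix_mult.add_left scalar_matrix_assoc)
  \<comment> \<open>The matrix inverted in \<open>C\<close> is \<open>R\<close> divided by
    \<mu>.\<close>
  have "(\<mu> *\<^sub>R B) ** (A + inverse \<mu> *\<^sub>R mat 1) = B ** R"
    using \<open>\<mu> > 0\<close>
    by (simp add: R_def matrix_mult.add_right matrix_mult.scaleR_right matrix_mult.scaleR_left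
        scaleR_add_right)
  then have "matrix_inv (A + inverse \<mu> *\<^sub>R mat 1) = \<mu> *\<^sub>R B"
    using BR by (simp add: matrix_inv_unique)
  then have C: "C = B ** (\<mu> *\<^sub>R transpose M)"
    using assms(3) by (simp add: A_def matrix_mult.scaleR_right matrix_mult.scaleR_left)
  have \<phi>: "\<phi> \<Phi> = B ** (\<Phi> + \<mu> *\<^sub>R transpose M)" for \<Phi>
    by (simp add: assms(4) C matrix_add_ldistrib)
  have R\<phi>: "R ** \<phi> \<Phi> = \<Phi> + \<mu> *\<^sub>R transpose M" for \<Phi>
    by (simp add: \<phi> matrix_mul_assoc RB)

  have "R ** pseudo_inverse M = pseudo_inverse M + \<mu> *\<^sub>R transpose M"
    by (simp add: Rmult A_def pseudo_inverse_normal_equation)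
  then have fixpoint: "pseudo_inverse M = \<phi> (pseudo_inverse M)"
    by (metis \<phi> BR matrix_mul_assoc matrix_mul_lid)

  have argmin: "argmin_set (\<lambda>\<Psi>. 1/2 * (frobenius_norm (M ** \<Psi> - mat 1))\<^sup>2
      + 1 / (2 * \<mu>) * (frobenius_norm (\<Psi> - \<Phi>))\<^sup>2) = {B ** \<Phi> + C}" for \<Phi>
  proof (rule argmin_set_eq_singleton)
    fix \<Psi> :: "real^'m^'n" assume "\<Psi> \<noteq> B ** \<Phi> + C"
    then have "0 < 1/2 * (norm (M ** (\<Psi> - \<phi> \<Phi>)))\<^sup>2 + 1 / (2 * \<mu>) * (norm (\<Psi> - \<phi> \<Phi>))\<^sup>2"
      using \<open>\<mu> > 0\<close> by (simp add: assms(4) add_nonneg_pos)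
    moreover have "\<phi> \<Phi> + \<mu> *\<^sub>R (transpose M ** M ** \<phi> \<Phi>) = \<Phi> + \<mu> *\<^sub>R (transpose M ** mat 1)"
      using R\<phi>[of \<Phi>] by (simp add: Rmult A_def)
    note proximal_objective_expansion[OF \<open>\<mu> > 0\<close> this, of \<Psi>]
    ultimately show "1/2 * (frobenius_norm (M ** (B ** \<Phi> + C) - mat 1))\<^sup>2
        + 1 / (2 * \<mu>) * (frobenius_norm (B ** \<Phi> + C - \<Phi>))\<^sup>2
      < 1/2 * (frobenius_norm (M ** \<Psi> - mat 1))\<^sup>2
        + 1 / (2 * \<mu>) * (frobenius_norm (\<Psi> - \<Phi>))\<^sup>2"
      unfolding frobenius_norm_eq_norm assms(4) by linarith
  qed

  \<comment> \<open>Subtracting two instances of \<open>R\<phi>\<close> cancels the constant term,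
    so \<open>\<Phi> - \<Psi>\<close> is \<open>R\<close> applied to the difference of the
    images.\<close>
  have R_diff: "\<Phi> - \<Psi> = (\<phi> \<Phi> - \<phi> \<Psi>) + \<mu> *\<^sub>R (transpose M ** M ** (\<phi> \<Phi> - \<phi> \<Psi>))" for \<Phi> \<Psi>
    using R\<phi>[of \<Phi>] R\<phi>[of \<Psi>] by (simp add: Rmult A_def matrix_mult.diff_right algebra_simps)
  have expand: "(norm (\<Phi> - \<Psi>))\<^sup>2 = (norm (\<phi> \<Phi> - \<phi> \<Psi>))\<^sup>2
      + 2 * \<mu> * (norm (M ** (\<phi> \<Phi> - \<phi> \<Psi>)))\<^sup>2 + \<mu>\<^sup>2 * (norm (A ** (\<phi> \<Phi> - \<phi> \<Psi>)))\<^sup>2" for \<Phi> \<Psi>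
    using norm_resolvent_square[of "\<phi> \<Phi> - \<phi> \<Psi>" \<mu> M] R_diff[of \<Phi> \<Psi>] by (simp add: A_def)
  \<comment> \<open>The term with \<open>A\<close> is kept because it controls the image difference
    once \<open>A\<close> is invertible.\<close>
  have lower: "(norm (\<phi> \<Phi> - \<phi> \<Psi>))\<^sup>2 + \<mu>\<^sup>2 * (norm (A ** (\<phi> \<Phi> - \<phi> \<Psi>)))\<^sup>2 \<le> (norm (\<Phi> - \<Psi>))\<^sup>2"
    for \<Phi> \<Psi>
    using expand[of \<Phi> \<Psi>] \<open>\<mu> > 0\<close> by simp
  have contr: "contraction \<phi>"
    unfolding contraction_def frobenius_norm_eq_norm
  proof (intro allI)
    fix \<Phi> \<Psi>
    have "0 \<le> \<mu>\<^sup>2 * (norm (A ** (\<phi> \<Phi> - \<phi> \<Psi>)))\<^sup>2"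
      by simp
    then have "(norm (\<phi> \<Phi> - \<phi> \<Psi>))\<^sup>2 \<le> (norm (\<Phi> - \<Psi>))\<^sup>2"
      using lower[of \<Phi> \<Psi>] by linarith
    then show "norm (\<phi> \<Phi> - \<phi> \<Psi>) \<le> norm (\<Phi> - \<Psi>)"
      by (rule power2_le_imp_le) simp
  qed

  have strict: "strict_contraction \<phi>" if pd: "positive_definite A"
  proof -
    obtain T where T: "T ** A = mat 1"
      using pd matrix_left_inverse_if_definite[of A] unfolding positive_definite_def by blast
    obtain K where "K > 0"
      and K: "\<And>Z :: real^'m^'n. norm (T ** Z) \<le> norm Z * K"
      using bounded_linear.pos_bounded[OF matrix_mult.bounded_linear_right] by metis
    \<comment> \<open>From \<open>T ** A = mat 1\<close> follows
      \<open>norm Z \<le> K * norm (A ** Z)\<close>. Inserted into \<open>lower\<close>, this bounds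
      \<open>q\<close> times the squared image distance by the squared distance, so
      \<open>1 / sqrt q\<close> is a Lipschitz constant.\<close>
    define q where "q = 1 + \<mu>\<^sup>2 / K\<^sup>2"
    have "q > 1"
      using \<open>K > 0\<close> \<open>\<mu> > 0\<close> by (simp add: q_def)
    have "norm (\<phi> \<Phi> - \<phi> \<Psi>) \<le> 1 / sqrt q * norm (\<Phi> - \<Psi>)" for \<Phi> \<Psi>
    proof -
      let ?Z = "\<phi> \<Phi> - \<phi> \<Psi>"
      have "norm ?Z \<le> norm (A ** ?Z) * K"
        using K[of "A ** ?Z"] by (simp add: matrix_mul_assoc T)
      then have "(norm ?Z)\<^sup>2 \<le> (norm (A ** ?Z))\<^sup>2 * K\<^sup>2"
        by (metis norm_ge_zero power_mono power_mult_distrib)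
      then have "(norm ?Z)\<^sup>2 / K\<^sup>2 \<le> (norm (A ** ?Z))\<^sup>2"
        using \<open>K > 0\<close> by (simp add: divide_le_eq)
      then have "\<mu>\<^sup>2 * ((norm ?Z)\<^sup>2 / K\<^sup>2) \<le> \<mu>\<^sup>2 * (norm (A ** ?Z))\<^sup>2"
        by (rule mult_left_mono) simp
      then have "q * (norm ?Z)\<^sup>2 \<le> (norm (\<Phi> - \<Psi>))\<^sup>2"
        using lower[of \<Phi> \<Psi>] by (simp add: q_def distrib_right)
      then have "(sqrt q * norm ?Z)\<^sup>2 \<le> (norm (\<Phi> - \<Psi>))\<^sup>2"
        using \<open>q > 1\<close> by (simp add: power_mult_distrib)
      then have "sqrt q * norm ?Z \<le> norm (\<Phi> - \<Psi>)"
        by (rule power2_le_imp_le) simp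
      then show ?thesis
        using \<open>q > 1\<close> by (simp add: field_simps)
    qed
    moreover have "1 / sqrt q < 1"
      using \<open>q > 1\<close> by simp
    ultimately show ?thesis
      unfolding strict_contraction_def frobenius_norm_eq_norm by blast
  qed

  \<comment> \<open>Rewriting with \<open>argmin\<close> reduces the proximal iteration to an
    equality of singletons for each \<open>k\<close>, which is the fixed point recursion.\<close>
  show ?thesis
    using fixpoint contr strict unfolding A_def proximal_iteration_def argmin by auto
qed

end
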